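(* Let $A_1=(\mathcal{S}_1,\mathcal{E},\mathcal{I}_1,\mathcal{F}_1,\to_1)$ and $A_2=(\mathcal{S}_2,\mathcal{E},\mathcal{I}_2,\mathcal{F}_2,\to_2)$ be Büchi automata over the same set of events. For $X\subseteq\mathcal{S}_1\times\mathcal{S}_2$ define $$\texttt{fsim}^\texttt{W}_\texttt{rdelay}(X)\triangleq\mu Y.\ \{(s_1,s_2)\mid\forall e.\forall s_1\xrightarrow{e}_1 s_1'.\exists s_2\xrightarrow{e}_2 s_2'.\ (s_1',s_2')\in Y\}\ \cup\ X,$$ $$\texttt{fsim}^\texttt{R}_\texttt{rdelay}(X)\triangleq\mu Y.\ \{(s_1,s_2)\mid s_2\in\mathcal{F}_2\wedge\forall e.\forall s_1\xrightarrow{e}_1 s_1'.\exists s_2\xrightarrow{e}_2 s_2'.\ (s_1',s_2')\in\texttt{fsim}^\texttt{W}_\texttt{rdelay}(X)\}\ \cup\ \{(s_1,s_2)\mid \forall e.\forall s_1\xrightarrow{e}_1 s_1'.\exists s_2\xrightarrow{e}_2 s_2'.\ (s_1',s_2')\in Y\},$$ $$\texttt{fsim}^\texttt{L}_\texttt{rdelay}\triangleq\nu X.\ \texttt{fsim}^\texttt{R}_\texttt{rdelay}(X)\ \cup\ \{(s_1,s_2)\mid s_1\notin\mathcal{F}_1\wedge\forall e.\forall s_1\xrightarrow{e}_1 s_1'.\exists s_2\xrightarrow{e}_2 s_2'.\ (s_1',s_2')\in X\},$$ and the repeated delay simulation $\texttt{fsim}_\texttt{rdelay}\triangleq\texttt{fsim}^\texttt{W}_\texttt{rdelay}(\texttt{fsim}^\texttt{L}_\texttt{rdelay})$.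 Then for all $(s_1,s_2)\in\texttt{fsim}_\texttt{rdelay}$, $\mathcal{L}_{A_1}(s_1)\subseteq\mathcal{L}_{A_2}(s_2)$.
   Context: A Büchi automaton $(\mathcal{S},\mathcal{E},\mathcal{I},\mathcal{F},\to)$ consists of a set of states $\mathcal{S}$ (not necessarily finite), a set of events $\mathcal{E}$, initial states $\mathcal{I}\subseteq\mathcal{S}$, accepting states $\mathcal{F}\subseteq\mathcal{S}$, and a labeled transition relation $\to\subseteq\mathcal{S}\times\mathcal{E}\times\mathcal{S}$ (written $s\xrightarrow{e}s'$). $\nu$ and $\mu$ denote greatest and least fixed points of monotone operators on powerset lattices (all operators above are monotone in $X$ and $Y$). The language of automaton $A$ is $\mathcal{L}_A\triangleq\nu L.\ \mu X.\ \{(s,e\cdot\tau)\mid \exists s\xrightarrow{e}s'.\ (s',\tau)\in X\}\cup\{(s,e\cdot\tau)\mid s\in\mathcal{F}\wedge \exists s\xrightarrow{e}s'.\ (s',\tau)\in L\}\subseteq\mathcal{S}\times\mathcal{E}^\omega$, and $\mathcal{L}_A(s)\triangleq\{\tau\mid (s,\tau)\in\mathcal{L}_A\}$. *)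

theory Defs
  imports Main "HOL-Library.Stream"
begin

record ('s, 'e) buchi =
  states :: "'s set"
  events :: "'e set"
  initial :: "'s set"
  accepting :: "'s set"
  transitions :: "('s \<times> 'e \<times> 's) set"

definition buchi_automaton :: "('s, 'e) buchi \<Rightarrow> bool" where
  "buchi_automaton A \<longleftrightarrow>
     initial A \<subseteq> states A \<and>
     accepting A \<subseteq> states A \<and>
     transitions A \<subseteq> states A \<times> events A \<times> states A"

(* The fixed points live in the powerset lattice of states A \<times> streams (events A), while
   gfp and lfp range over all sets of the ambient type.  The two agree: every pair added by the
   operator starts with a transition, so post-fixed points stay in that product
   (buchi_lang_subset below). *)
definition buchi_lang :: "('s, 'e) buchi \<Rightarrow> ('s \<times> 'e stream) set" where
  "buchi_lang A =
     gfp (\<lambda>L. lfp (\<lambda>X.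
       {(s, e ## \<tau>) | s e \<tau>. \<exists>s'. (s, e, s') \<in> transitions A \<and> (s', \<tau>) \<in> X} \<union>
       {(s, e ## \<tau>) | s e \<tau>. s \<in> accepting A \<and>
          (\<exists>s'. (s, e, s') \<in> transitions A \<and> (s', \<tau>) \<in> L)}))"

definition lang :: "('s, 'e) buchi \<Rightarrow> 's \<Rightarrow> 'e stream set" where
  "lang A s = {\<tau>. (s, \<tau>) \<in> buchi_lang A}"

(* The pairs whose left moves can all be answered into Y.  A pair without left moves satisfies
   the condition vacuously, so membership in the state sets has to be required explicitly. *)
definition sim_step ::
  "('s, 'e) buchi \<Rightarrow> ('t, 'e) buchi \<Rightarrow> ('s \<times> 't) set \<Rightarrow> ('s \<times> 't) set" where
  "sim_step A1 A2 Y =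
     {(s1, s2). s1 \<in> states A1 \<and> s2 \<in> states A2 \<and>
        (\<forall>e s1'. (s1, e, s1') \<in> transitions A1 \<longrightarrow>
           (\<exists>s2'. (s2, e, s2') \<in> transitions A2 \<and> (s1', s2') \<in> Y))}"

definition fsim_W_rdelay ::
  "('s, 'e) buchi \<Rightarrow> ('t, 'e) buchi \<Rightarrow> ('s \<times> 't) set \<Rightarrow> ('s \<times> 't) set" where
  "fsim_W_rdelay A1 A2 X = lfp (\<lambda>Y. sim_step A1 A2 Y \<union> X)"

definition fsim_R_rdelay ::
  "('s, 'e) buchi \<Rightarrow> ('t, 'e) buchi \<Rightarrow> ('s \<times> 't) set \<Rightarrow> ('s \<times> 't) set" where
  "fsim_R_rdelay A1 A2 X =
     lfp (\<lambda>Y. {(s1, s2). s2 \<in> accepting A2 \<and>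
                 (s1, s2) \<in> sim_step A1 A2 (fsim_W_rdelay A1 A2 X)} \<union>
               sim_step A1 A2 Y)"

definition fsim_L_rdelay ::
  "('s, 'e) buchi \<Rightarrow> ('t, 'e) buchi \<Rightarrow> ('s \<times> 't) set" where
  "fsim_L_rdelay A1 A2 =
     gfp (\<lambda>X. fsim_R_rdelay A1 A2 X \<union>
               {(s1, s2). s1 \<notin> accepting A1 \<and> (s1, s2) \<in> sim_step A1 A2 X})"

definition fsim_rdelay ::
  "('s, 'e) buchi \<Rightarrow> ('t, 'e) buchi \<Rightarrow> ('s \<times> 't) set" where
  "fsim_rdelay A1 A2 = fsim_W_rdelay A1 A2 (fsim_L_rdelay A1 A2)"

lemma sim_step_mono: "X \<subseteq> Y \<Longrightarrow> sim_step A1 A2 X \<subseteq> sim_step A1 A2 Y"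
  unfolding sim_step_def by blast

lemma sim_step_subset: "sim_step A1 A2 Y \<subseteq> states A1 \<times> states A2"
  unfolding sim_step_def by blast

lemma fsim_W_rdelay_mono:
  "X \<subseteq> X' \<Longrightarrow> fsim_W_rdelay A1 A2 X \<subseteq> fsim_W_rdelay A1 A2 X'"
  unfolding fsim_W_rdelay_def by (rule lfp_mono) blast

lemma fsim_R_rdelay_mono:
  "X \<subseteq> X' \<Longrightarrow> fsim_R_rdelay A1 A2 X \<subseteq> fsim_R_rdelay A1 A2 X'"
  unfolding fsim_R_rdelay_def
  using sim_step_mono[OF fsim_W_rdelay_mono[of X X' A1 A2], of A1 A2]
  by (intro lfp_mono) blast

lemma fsim_R_rdelay_subset: "fsim_R_rdelay A1 A2 X \<subseteq> states A1 \<times> states A2"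
  unfolding fsim_R_rdelay_def
  using sim_step_subset[of A1 A2] by (intro lfp_lowerbound) blast

lemma fsim_L_rdelay_subset: "fsim_L_rdelay A1 A2 \<subseteq> states A1 \<times> states A2"
  unfolding fsim_L_rdelay_def
proof (rule gfp_least)
  fix X
  assume "X \<subseteq> fsim_R_rdelay A1 A2 X \<union>
               {(s1, s2). s1 \<notin> accepting A1 \<and> (s1, s2) \<in> sim_step A1 A2 X}"
  then show "X \<subseteq> states A1 \<times> states A2"
    using fsim_R_rdelay_subset[of A1 A2 X] sim_step_subset[of A1 A2 X] by blast
qed

lemma fsim_rdelay_subset: "fsim_rdelay A1 A2 \<subseteq> states A1 \<times> states A2"
  unfolding fsim_rdelay_def fsim_W_rdelay_def
  using sim_step_subset[of A1 A2] fsim_L_rdelay_subset[of A1 A2]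
  by (intro lfp_lowerbound) blast

lemma buchi_lang_subset:
  assumes "buchi_automaton A"
  shows "buchi_lang A \<subseteq> states A \<times> streams (events A)"
proof -
  have tr: "s \<in> states A \<and> e \<in> events A" if "(s, e, s') \<in> transitions A" for s e s'
    using assms that by (auto simp: buchi_automaton_def)
  let ?P = "{(s, \<tau>). \<exists>e \<tau>' s'. \<tau> = e ## \<tau>' \<and> (s, e, s') \<in> transitions A \<and> (s', \<tau>') \<in> buchi_lang A}"
  let ?F = "\<lambda>L X. {(s, e ## \<tau>) | s e \<tau>. \<exists>s'. (s, e, s') \<in> transitions A \<and> (s', \<tau>) \<in> X} \<union>
       {(s, e ## \<tau>) | s e \<tau>. s \<in> accepting A \<and>
          (\<exists>s'. (s, e, s') \<in> transitions A \<and> (s', \<tau>) \<in> L)}"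
  have mX: "mono (?F L)" for L by (rule monoI) blast
  have mL: "mono (\<lambda>L. lfp (?F L))"
    by (rule monoI, rule lfp_mono) blast
  have L: "buchi_lang A = lfp (?F (buchi_lang A))"
    unfolding buchi_lang_def using gfp_unfold[OF mL] .
  then have L': "buchi_lang A = ?F (buchi_lang A) (buchi_lang A)"
    using lfp_unfold[OF mX, of "buchi_lang A"] by simp
  then have step: "(s, \<tau>) \<in> ?P" if "(s, \<tau>) \<in> buchi_lang A" for s \<tau>
    using that by blast
  have "\<tau> \<in> streams (events A)" if "(s, \<tau>) \<in> buchi_lang A" for s \<tau>
    using that
  proof (coinduction arbitrary: s \<tau> rule: streams.coinduct)
    case (streams s \<tau>)
    then show ?case using step[of s \<tau>] tr by blast
  qed
  moreover have "s \<in> states A" if "(s, \<tau>) \<in> buchi_lang A" for s \<tau>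
    using step[OF that] tr by blast
  ultimately show ?thesis by auto
qed

end

(* The pairs (s2, \<tau>) such that some s1 related to s2 accepts \<tau> form a post-fixed point of the
   operator defining the language of A2. After unfolding the inner fixed point, every such pair
   has to reach an accepting transition of A2 in finitely many steps. While the game is in the
   W phase or in the R phase, this follows by induction on the respective least fixed point. In
   the L phase it follows by induction on the number of steps until the A1-run leaves an accepting
   state, since the R phase can be postponed only at non-accepting states of A1. *)
theory Submission
  imports Defs
begin

text \<open>The operator under both binders of \<open>buchi_lang\<close>: \<open>L\<close> is the
  greatest fixed point variable, \<open>X\<close> the least one. Naming it allows the inner fixed
  point to be taken at sets other than the language.\<close>

definition lang_step ::
  "('s, 'e) buchi \<Rightarrow> ('s \<times> 'e stream) set \<Rightarrow> ('s \<times> 'e stream) set \<Rightarrow> ('s \<times> 'e stream) set" where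
  "lang_step A L X =
     {(s, e ## \<tau>) | s e \<tau>. \<exists>s'. (s, e, s') \<in> transitions A \<and> (s', \<tau>) \<in> X} \<union>
     {(s, e ## \<tau>) | s e \<tau>. s \<in> accepting A \<and>
        (\<exists>s'. (s, e, s') \<in> transitions A \<and> (s', \<tau>) \<in> L)}"

lemma lang_step_mono: "L \<subseteq> L' \<Longrightarrow> X \<subseteq> X' \<Longrightarrow> lang_step A L X \<subseteq> lang_step A L' X'"
  unfolding lang_step_def by blast

lemma mono_lang_step: "mono (lang_step A L)"
  by (intro monoI lang_step_mono order_refl)

lemma mono_lfp_lang_step: "mono (\<lambda>L. lfp (lang_step A L))"
  by (intro monoI lfp_mono lang_step_mono order_refl)

lemma buchi_lang_eq_gfp: "buchi_lang A = gfp (\<lambda>L. lfp (lang_step A L))"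
  unfolding buchi_lang_def lang_step_def ..

lemma buchi_lang_eq_lfp: "buchi_lang A = lfp (lang_step A (buchi_lang A))"
  unfolding buchi_lang_eq_gfp by (rule gfp_unfold[OF mono_lfp_lang_step])

lemma lfp_lang_step_step:
  "\<lbrakk>(s, e, s') \<in> transitions A; (s', \<tau>) \<in> lfp (lang_step A L)\<rbrakk> \<Longrightarrow> (s, e ## \<tau>) \<in> lfp (lang_step A L)"
  by (subst lfp_unfold[OF mono_lang_step]) (auto simp: lang_step_def)

lemma lfp_lang_step_accept:
  "\<lbrakk>s \<in> accepting A; (s, e, s') \<in> transitions A; (s', \<tau>) \<in> L\<rbrakk> \<Longrightarrow> (s, e ## \<tau>) \<in> lfp (lang_step A L)"
  by (subst lfp_unfold[OF mono_lang_step]) (auto simp: lang_step_def)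

text \<open>The language is the inner least fixed point taken at itself, so one can induct on the
  distance to the next accepting transition. No induction hypothesis comes with
  \<open>accept\<close>, since the distance starts afresh there.\<close>

lemma buchi_lang_induct [consumes 1, case_names step accept]:
  assumes "(s, \<tau>) \<in> buchi_lang A"
    and "\<And>s e s' \<tau>. \<lbrakk>(s, e, s') \<in> transitions A; (s', \<tau>) \<in> buchi_lang A; P s' \<tau>\<rbrakk> \<Longrightarrow> P s (e ## \<tau>)"
    and "\<And>s e s' \<tau>. \<lbrakk>s \<in> accepting A; (s, e, s') \<in> transitions A; (s', \<tau>) \<in> buchi_lang A\<rbrakk>
           \<Longrightarrow> P s (e ## \<tau>)"
  shows "P s \<tau>"
proof -
  have "(s, \<tau>) \<in> lfp (lang_step A (buchi_lang A))"
    using assms(1) buchi_lang_eq_lfp by blast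
  then show ?thesis
  proof (induction rule: lfp_induct2[OF _ mono_lang_step, consumes 1, case_names unfold])
    case (unfold s \<tau>)
    then show ?case
      using assms(2,3) unfolding lang_step_def buchi_lang_eq_lfp[symmetric] by blast
  qed
qed

lemma buchi_lang_cases:
  assumes "(s, \<tau>) \<in> buchi_lang A"
  obtains e s' \<tau>' where "\<tau> = e ## \<tau>'" "(s, e, s') \<in> transitions A" "(s', \<tau>') \<in> buchi_lang A"
  using assms by (induction rule: buchi_lang_induct) auto

lemma buchi_lang_step:
  "\<lbrakk>(s, e, s') \<in> transitions A; (s', \<tau>) \<in> buchi_lang A\<rbrakk> \<Longrightarrow> (s, e ## \<tau>) \<in> buchi_lang A"
  using lfp_lang_step_step[of s e s' A \<tau> "buchi_lang A"] buchi_lang_eq_lfp[of A] by simp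

lemma buchi_lang_coinduct: "L \<subseteq> lfp (lang_step A L) \<Longrightarrow> L \<subseteq> buchi_lang A"
  unfolding buchi_lang_eq_gfp by (rule gfp_upperbound)

lemma sim_stepD:
  assumes "(s1, s2) \<in> sim_step A1 A2 Y" "(s1, e, s1') \<in> transitions A1"
  obtains s2' where "(s2, e, s2') \<in> transitions A2" "(s1', s2') \<in> Y"
  using assms unfolding sim_step_def by blast

text \<open>The induction hypothesis sits inside \<open>sim_step\<close>: every left move has some
  answer that satisfies \<open>P\<close>.\<close>

lemma fsim_W_rdelay_induct [consumes 1, case_names step base]:
  assumes "(s1, s2) \<in> fsim_W_rdelay A1 A2 X"
    and "\<And>s1 s2. (s1, s2) \<in> sim_step A1 A2 {(t1, t2). P t1 t2} \<Longrightarrow> P s1 s2"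
    and "\<And>s1 s2. (s1, s2) \<in> X \<Longrightarrow> P s1 s2"
  shows "P s1 s2"
proof -
  have "fsim_W_rdelay A1 A2 X \<subseteq> {(t1, t2). P t1 t2}"
    unfolding fsim_W_rdelay_def using assms(2,3) by (intro lfp_lowerbound) auto
  then show ?thesis
    using assms(1) by blast
qed

lemma fsim_R_rdelay_induct [consumes 1, case_names accept step]:
  assumes "(s1, s2) \<in> fsim_R_rdelay A1 A2 X"
    and "\<And>s1 s2. \<lbrakk>s2 \<in> accepting A2; (s1, s2) \<in> sim_step A1 A2 (fsim_W_rdelay A1 A2 X)\<rbrakk>
           \<Longrightarrow> P s1 s2"
    and "\<And>s1 s2. (s1, s2) \<in> sim_step A1 A2 {(t1, t2). P t1 t2} \<Longrightarrow> P s1 s2"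
  shows "P s1 s2"
proof -
  have "fsim_R_rdelay A1 A2 X \<subseteq> {(t1, t2). P t1 t2}"
    unfolding fsim_R_rdelay_def using assms(2,3) by (intro lfp_lowerbound) auto
  then show ?thesis
    using assms(1) by blast
qed

lemma fsim_L_rdelay_cases:
  assumes "(s1, s2) \<in> fsim_L_rdelay A1 A2"
  obtains "(s1, s2) \<in> fsim_R_rdelay A1 A2 (fsim_L_rdelay A1 A2)"
  | "s1 \<notin> accepting A1" "(s1, s2) \<in> sim_step A1 A2 (fsim_L_rdelay A1 A2)"
proof -
  let ?F = "\<lambda>X. fsim_R_rdelay A1 A2 X \<union>
    {(s1, s2). s1 \<notin> accepting A1 \<and> (s1, s2) \<in> sim_step A1 A2 X}"
  have "mono ?F"
  proof (rule monoI)
    fix X Y :: "('a \<times> 'b) set"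
    assume "X \<subseteq> Y"
    then show "?F X \<subseteq> ?F Y"
      using fsim_R_rdelay_mono[of X Y A1 A2] sim_step_mono[of X Y A1 A2] by blast
  qed
  then have "fsim_L_rdelay A1 A2 = ?F (fsim_L_rdelay A1 A2)"
    unfolding fsim_L_rdelay_def by (rule gfp_unfold)
  then show thesis
    using assms that by blast
qed

text \<open>For \<open>R = fsim_rdelay A1 A2\<close> this is the candidate for the coinduction on
  the language of \<open>A2\<close>.\<close>

definition sim_lang ::
  "('s, 'e) buchi \<Rightarrow> ('s \<times> 't) set \<Rightarrow> ('t \<times> 'e stream) set" where
  "sim_lang A R = {(s2, \<tau>). \<exists>s1. (s1, s2) \<in> R \<and> (s1, \<tau>) \<in> buchi_lang A}"

text \<open>The inductive step shared by the W and R phases: the first transition of the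
  \<open>A1\<close>-run is answered in \<open>A2\<close>, and prefixing a transition stays inside
  the inner fixed point. The hypothesis covers all words because a move passes to the tail.\<close>

lemma sim_step_lang:
  assumes "(s1, s2) \<in> sim_step A1 A2
      {(t1, t2). \<forall>\<tau>. (t1, \<tau>) \<in> buchi_lang A1 \<longrightarrow> (t2, \<tau>) \<in> lfp (lang_step A2 L)}"
    and "(s1, \<tau>) \<in> buchi_lang A1"
  shows "(s2, \<tau>) \<in> lfp (lang_step A2 L)"
  using assms(2)
proof (cases rule: buchi_lang_cases)
  case (1 e s1' \<tau>')
  with assms(1) obtain s2' where "(s2, e, s2') \<in> transitions A2" "(s2', \<tau>') \<in> lfp (lang_step A2 L)"
    by (auto elim: sim_stepD)
  then show ?thesis
    unfolding 1(1) by (rule lfp_lang_step_step)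
qed

text \<open>The R phase ends at an accepting state of \<open>A2\<close>. The answer to the next move
  lands in the W phase, hence \<open>fsim_W_rdelay\<close> in the outer argument of
  \<open>lang_step\<close>.\<close>

lemma fsim_R_rdelay_lang:
  assumes "(s1, s2) \<in> fsim_R_rdelay A1 A2 X" "(s1, \<tau>) \<in> buchi_lang A1"
  shows "(s2, \<tau>) \<in> lfp (lang_step A2 (sim_lang A1 (fsim_W_rdelay A1 A2 X)))"
proof -
  have "\<forall>\<tau>. (s1, \<tau>) \<in> buchi_lang A1 \<longrightarrow>
      (s2, \<tau>) \<in> lfp (lang_step A2 (sim_lang A1 (fsim_W_rdelay A1 A2 X)))"
    using assms(1)
  proof (induction rule: fsim_R_rdelay_induct)
    case (accept s1 s2)
    show ?case
    proof (intro allI impI)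
      fix \<tau>
      assume "(s1, \<tau>) \<in> buchi_lang A1"
      then obtain e s1' \<tau>' where \<tau>: "\<tau> = e ## \<tau>'"
        and s1': "(s1, e, s1') \<in> transitions A1" "(s1', \<tau>') \<in> buchi_lang A1"
        by (rule buchi_lang_cases)
      from accept(2) s1'(1) obtain s2' where s2': "(s2, e, s2') \<in> transitions A2"
        and "(s1', s2') \<in> fsim_W_rdelay A1 A2 X"
        by (rule sim_stepD)
      with s1'(2) have "(s2', \<tau>') \<in> sim_lang A1 (fsim_W_rdelay A1 A2 X)"
        unfolding sim_lang_def by blast
      then show "(s2, \<tau>) \<in> lfp (lang_step A2 (sim_lang A1 (fsim_W_rdelay A1 A2 X)))"
        unfolding \<tau> by (rule lfp_lang_step_accept[OF accept(1) s2'])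
    qed
  next
    case (step s1 s2)
    show ?case
      by (intro allI impI sim_step_lang[OF step])
  qed
  then show ?thesis
    using assms(2) by blast
qed

text \<open>Each delaying move replaces \<open>s2\<close> by an answer, so \<open>s2\<close> is
  generalised in the induction along the \<open>A1\<close>-run.\<close>

lemma fsim_L_rdelay_lang:
  assumes "(s1, \<tau>) \<in> buchi_lang A1" "(s1, s2) \<in> fsim_L_rdelay A1 A2"
  shows "(s2, \<tau>) \<in> lfp (lang_step A2 (sim_lang A1 (fsim_rdelay A1 A2)))"
  using assms
proof (induction arbitrary: s2 rule: buchi_lang_induct)
  case (step s1 e s1' \<tau>)
  from step.prems show ?case
  proof (cases rule: fsim_L_rdelay_cases)
    case 1
    then show ?thesis
      \<comment> \<open>With \<open>X\<close> the L phase, the W phase over \<open>X\<close> is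
        \<open>fsim_rdelay\<close> itself, so the target matches the lemma on the R phase.\<close>
      unfolding fsim_rdelay_def by (rule fsim_R_rdelay_lang[OF _ buchi_lang_step[OF step.hyps]])
  next
    case 2
    from 2(2) step.hyps(1) obtain s2' where
      "(s2, e, s2') \<in> transitions A2" "(s1', s2') \<in> fsim_L_rdelay A1 A2"
      by (rule sim_stepD)
    then show ?thesis
      by (intro lfp_lang_step_step[of s2 e s2'] step.IH)
  qed
next
  case (accept s1 e s1' \<tau>)
  from accept.prems show ?case
  proof (cases rule: fsim_L_rdelay_cases)
    case 1
    then show ?thesis
      unfolding fsim_rdelay_def by (rule fsim_R_rdelay_lang[OF _ buchi_lang_step[OF accept.hyps(2,3)]])
  \<comment> \<open>The remaining alternative, a delay, contradicts \<open>s1\<close> being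
    accepting.\<close>
  qed (use accept.hyps(1) in blast)
qed

lemma fsim_rdelay_lang:
  assumes "(s1, s2) \<in> fsim_rdelay A1 A2" "(s1, \<tau>) \<in> buchi_lang A1"
  shows "(s2, \<tau>) \<in> lfp (lang_step A2 (sim_lang A1 (fsim_rdelay A1 A2)))"
proof -
  have "(s1, s2) \<in> fsim_W_rdelay A1 A2 (fsim_L_rdelay A1 A2)"
    using assms(1) unfolding fsim_rdelay_def .
  then have "\<forall>\<tau>. (s1, \<tau>) \<in> buchi_lang A1 \<longrightarrow>
      (s2, \<tau>) \<in> lfp (lang_step A2 (sim_lang A1 (fsim_rdelay A1 A2)))"
  proof (induction rule: fsim_W_rdelay_induct)
    case (step s1 s2)
    show ?case
      by (intro allI impI sim_step_lang[OF step])
  next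
    case (base s1 s2)
    then show ?case
      by (intro allI impI fsim_L_rdelay_lang)
  qed
  then show ?thesis
    using assms(2) by blast
qed

theorem theorem5p8:
  fixes A1 :: "('s, 'e) buchi" and A2 :: "('t, 'e) buchi"
  assumes "buchi_automaton A1"
    and "buchi_automaton A2"
    and "events A1 = events A2"
  shows "\<forall>(s1, s2) \<in> fsim_rdelay A1 A2. lang A1 s1 \<subseteq> lang A2 s2"
proof -
  \<comment> \<open>The outer argument is again \<open>fsim_rdelay\<close>, since an accepting step
    leads back to the W phase; this closes the coinduction.\<close>
  have "sim_lang A1 (fsim_rdelay A1 A2) \<subseteq> lfp (lang_step A2 (sim_lang A1 (fsim_rdelay A1 A2)))"
  proof
    fix p
    assume "p \<in> sim_lang A1 (fsim_rdelay A1 A2)"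
    then obtain s1 s2 \<tau> where "p = (s2, \<tau>)" "(s1, s2) \<in> fsim_rdelay A1 A2" "(s1, \<tau>) \<in> buchi_lang A1"
      unfolding sim_lang_def by blast
    then show "p \<in> lfp (lang_step A2 (sim_lang A1 (fsim_rdelay A1 A2)))"
      by (simp add: fsim_rdelay_lang)
  qed
  then have "sim_lang A1 (fsim_rdelay A1 A2) \<subseteq> buchi_lang A2"
    by (rule buchi_lang_coinduct)
  then show ?thesis
    unfolding sim_lang_def lang_def by blast
qed

end
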